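(* For a nonnegative $n\times n$ matrix $A$ to have Property 1 it is necessary and sufficient that $A$ and $A^{\top}A$ be irreducible.
   Context: $r(\cdot)$ denotes the spectral radius, $\mathcal{D}_n$ the set of $n\times n$ real diagonal matrices, $I$ the identity matrix, and $A^{\top}$ the transpose of $A$. Property 1: a nonnegative $n\times n$ matrix $A$ is said to have Property 1 when the equality $\log r(e^{(1-t)C+tD}A)=(1-t)\log r(e^{C}A)+t\log r(e^{D}A)$, for $C,D\in\mathcal{D}_n$ and some $t\in(0,1)$, implies that $C-D$ is a scalar matrix, i.e. $C-D=cI$ for some $c\in\mathbb{R}$; or equivalently, when $C-D$ being nonscalar implies for all $t\in(0,1)$ that $\log r(e^{(1-t)C+tD}A)<(1-t)\log r(e^{C}A)+t\log r(e^{D}A)$. Irreducibility: an $n\times n$ matrix $A$ is irreducible if the index set $\{1,\dots,n\}$ cannot be partitioned into two nonempty sets $S_1,S_2$ such that $A_{ij}=0$ for all $i\in S_1$, $j\in S_2$. *)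

theory Defs
  imports "Jordan_Normal_Form.Spectral_Radius"
begin

definition nonneg_mat :: "real mat \<Rightarrow> bool" where
  "nonneg_mat A \<longleftrightarrow> (\<forall>i<dim_row A. \<forall>j<dim_col A. 0 \<le> A $$ (i, j))"

definition irreducible_mat :: "nat \<Rightarrow> real mat \<Rightarrow> bool" where
  "irreducible_mat n A \<longleftrightarrow>
     \<not> (\<exists>S1 S2. S1 \<noteq> {} \<and> S2 \<noteq> {} \<and> S1 \<inter> S2 = {} \<and> S1 \<union> S2 = {0..<n} \<and>
          (\<forall>i\<in>S1. \<forall>j\<in>S2. A $$ (i, j) = 0))"

(* The power series sum_k M^k / k!, taken entrywise; the type of matrices of
   arbitrary size is not a normed algebra, so the library's exp does not apply. *)
definition mat_exp :: "real mat \<Rightarrow> real mat" where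
  "mat_exp M = mat (dim_row M) (dim_row M) (\<lambda>(i, j). \<Sum>k. (M ^\<^sub>m k) $$ (i, j) / fact k)"

definition real_spectral_radius :: "real mat \<Rightarrow> real" where
  "real_spectral_radius A = spectral_radius (map_mat complex_of_real A)"

definition real_diagonal_mats :: "nat \<Rightarrow> real mat set" where
  "real_diagonal_mats n = {D \<in> carrier_mat n n. diagonal_mat D}"

(* In the library ln 0 = 0 instead of log 0 = -infinity. Here the difference is
   immaterial: for nonnegative A, the zero pattern of e^D A does not depend on
   the diagonal matrix D, so the three spectral radii below are either all positive
   or all zero, and in the latter case the equation is true under both conventions. *)
definition property1 :: "nat \<Rightarrow> real mat \<Rightarrow> bool" where
  "property1 n A \<longleftrightarrow>
     (\<forall>C \<in> real_diagonal_mats n. \<forall>D \<in> real_diagonal_mats n.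
        (\<exists>t\<in>{0<..<1}.
           ln (real_spectral_radius (mat_exp ((1 - t) \<cdot>\<^sub>m C + t \<cdot>\<^sub>m D) * A)) =
             (1 - t) * ln (real_spectral_radius (mat_exp C * A))
             + t * ln (real_spectral_radius (mat_exp D * A)))
        \<longrightarrow> (\<exists>c. C - D = c \<cdot>\<^sub>m 1\<^sub>m n))"

lemma diagonal_pow_mat:
  assumes "D \<in> real_diagonal_mats n"
  shows "D ^\<^sub>m k = mat_diag n (\<lambda>i. (D $$ (i, i)) ^ k)"
proof -
  have D: "D \<in> carrier_mat n n" and eq: "D = mat_diag n (\<lambda>i. D $$ (i, i))"
    using assms unfolding real_diagonal_mats_def diagonal_mat_def mat_diag_def
    by (auto intro!: eq_matI)
  show ?thesis
  proof (induction k)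
    case 0
    then show ?case using D by simp
  next
    case (Suc k)
    have "D ^\<^sub>m Suc k = mat_diag n (\<lambda>i. (D $$ (i, i)) ^ k) * mat_diag n (\<lambda>i. D $$ (i, i))"
      using Suc eq by simp
    then show ?case by (simp add: mult.commute)
  qed
qed

lemma mat_exp_diagonal:
  assumes "D \<in> real_diagonal_mats n"
  shows "mat_exp D = mat_diag n (\<lambda>i. exp (D $$ (i, i)))"
proof -
  have D: "D \<in> carrier_mat n n"
    using assms by (simp add: real_diagonal_mats_def)
  have "(\<Sum>k. (D ^\<^sub>m k) $$ (i, j) / fact k) = (if i = j then exp (D $$ (i, i)) else 0)"
    if "i < n" "j < n" for i j
    using that
    by (auto simp: diagonal_pow_mat[OF assms] mat_diag_def exp_def scaleR_conv_of_real field_simps)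
  then show ?thesis
    using D unfolding mat_exp_def mat_diag_def by (auto intro!: eq_matI)
qed

end

theory Submission
  imports Defs
begin

text \<open>Sufficiency: let \<open>u\<close> and \<open>v\<close> be Perron vectors of \<open>exp C * A\<close> and \<open>exp D * A\<close>, and put
  \<open>w = u powr (1 - t) * v powr t\<close> entrywise. By Hoelder's inequality \<open>w\<close> is a positive
  super-eigenvector of \<open>exp ((1 - t) C + t D) * A\<close> for the geometric mean of the two spectral radii.
  If that mean is the spectral radius, irreducibility makes \<open>w\<close> an eigenvector, so Hoelder's
  inequality is an equality in every row: \<open>u / v\<close> is constant on the support of each row of \<open>A\<close>.
  Irreducibility of \<open>A\<^sup>T * A\<close> says that these supports are linked together, so \<open>u\<close> and \<open>v\<close> are
  proportional, and comparing the two eigenvalue equations shows that \<open>C - D\<close> is scalar.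

  Necessity: if \<open>A\<close> is reducible, then scaling the rows of one diagonal block, up or down, changes the spectral
  radius log-linearly or not at all. If only \<open>A\<^sup>T * A\<close> is reducible, there is a nonscalar \<open>D\<close> for
  which every \<open>exp (s D) * A\<close> is diagonally similar to \<open>A\<close>.\<close>

section \<open>Eigenvalues and the spectral radius\<close>

text \<open>Vectors are plain functions of which only the values below \<open>n\<close> count, so
  entrywise norms, quotients and real powers carry no dimension conditions.\<close>

definition mat_act :: "nat \<Rightarrow> 'a::comm_ring_1 mat \<Rightarrow> (nat \<Rightarrow> 'a) \<Rightarrow> nat \<Rightarrow> 'a" where
  "mat_act n A x i = (\<Sum>j<n. A $$ (i, j) * x j)"

lemma eigenvalue_iff_mat_act:
  assumes "M \<in> carrier_mat n n"
  shows "eigenvalue M k \<longleftrightarrow> (\<exists>z. (\<exists>i<n. z i \<noteq> 0) \<and> (\<forall>i<n. mat_act n M z i = k * z i))"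
proof
  assume "eigenvalue M k"
  then obtain v where v: "v \<in> carrier_vec n" "v \<noteq> 0\<^sub>v n" "M *\<^sub>v v = k \<cdot>\<^sub>v v"
    using assms by (auto simp: eigenvalue_def eigenvector_def)
  have "\<exists>i<n. v $ i \<noteq> 0"
    using v(1,2) by (metis carrier_vecD eq_vecI index_zero_vec(1,2))
  moreover have "mat_act n M (\<lambda>i. v $ i) i = k * v $ i" if "i < n" for i
  proof -
    have "mat_act n M (\<lambda>i. v $ i) i = (M *\<^sub>v v) $ i"
      using that v(1) assms by (auto simp: mat_act_def scalar_prod_def atLeast0LessThan)
    then show ?thesis using v(1,3) that by simp
  qed
  ultimately show "\<exists>z. (\<exists>i<n. z i \<noteq> 0) \<and> (\<forall>i<n. mat_act n M z i = k * z i)" by blast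
next
  assume "\<exists>z. (\<exists>i<n. z i \<noteq> 0) \<and> (\<forall>i<n. mat_act n M z i = k * z i)"
  then obtain z i where z: "i < n" "z i \<noteq> 0" "\<And>i. i < n \<Longrightarrow> mat_act n M z i = k * z i" by blast
  have "vec n z \<noteq> 0\<^sub>v n"
    using z(1,2) by (metis index_vec index_zero_vec(1))
  moreover have "M *\<^sub>v vec n z = k \<cdot>\<^sub>v vec n z"
    using z(3) assms by (intro eq_vecI) (auto simp: mat_act_def scalar_prod_def atLeast0LessThan)
  ultimately show "eigenvalue M k"
    using assms by (auto simp: eigenvalue_def eigenvector_def intro: exI[of _ "vec n z"])
qed

abbreviation cmat :: "real mat \<Rightarrow> complex mat" where
  "cmat \<equiv> map_mat complex_of_real"

lemma real_spectral_radius_attained: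
  assumes "A \<in> carrier_mat n n" "n > 0"
  obtains k where "eigenvalue (cmat A) k" "norm k = real_spectral_radius A"
  using spectral_radius_mem_max(1)[of "cmat A" n] assms
  by (auto simp: real_spectral_radius_def spectrum_def)

lemma norm_le_real_spectral_radius:
  assumes "A \<in> carrier_mat n n" "n > 0" "eigenvalue (cmat A) k"
  shows "norm k \<le> real_spectral_radius A"
  using spectral_radius_mem_max(2)[of "cmat A" n] assms
  by (auto simp: real_spectral_radius_def spectrum_def)

lemma real_spectral_radius_nonneg:
  assumes "A \<in> carrier_mat n n" "n > 0"
  shows "0 \<le> real_spectral_radius A"
  using real_spectral_radius_attained[OF assms] by (metis norm_ge_zero)

text \<open>Dividing an eigenvalue of the multiple by \<open>c\<close> gives an eigenvalue of
  \<open>A\<close> with the same eigenvector. Using this with \<open>inverse c\<close> as well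
  yields the equality that follows.\<close>

lemma real_spectral_radius_smult_le:
  assumes "A \<in> carrier_mat n n" "n > 0" "c > 0"
  shows "real_spectral_radius (c \<cdot>\<^sub>m A) \<le> c * real_spectral_radius A"
proof -
  have cA: "c \<cdot>\<^sub>m A \<in> carrier_mat n n" using assms by simp
  obtain k where k: "eigenvalue (cmat (c \<cdot>\<^sub>m A)) k" "norm k = real_spectral_radius (c \<cdot>\<^sub>m A)"
    using real_spectral_radius_attained[OF cA assms(2)] .
  then obtain z where z: "\<exists>i<n. z i \<noteq> 0" "\<And>i. i < n \<Longrightarrow> mat_act n (cmat (c \<cdot>\<^sub>m A)) z i = k * z i"
    using eigenvalue_iff_mat_act[of "cmat (c \<cdot>\<^sub>m A)" n k] cA by auto
  have "mat_act n (cmat A) z i = (k / of_real c) * z i" if "i < n" for i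
  proof -
    have "mat_act n (cmat (c \<cdot>\<^sub>m A)) z i = of_real c * mat_act n (cmat A) z i"
      using that assms(1) by (simp add: mat_act_def sum_distrib_left mult.assoc)
    then show ?thesis using z(2)[OF that] assms(3) by (simp add: field_simps)
  qed
  then have "eigenvalue (cmat A) (k / of_real c)"
    using eigenvalue_iff_mat_act[of "cmat A" n] assms(1) z(1) by auto
  then have "norm (k / of_real c) \<le> real_spectral_radius A"
    using norm_le_real_spectral_radius assms by blast
  then show ?thesis using assms(3) k(2) by (simp add: norm_divide field_simps)
qed

lemma real_spectral_radius_smult:
  assumes "A \<in> carrier_mat n n" "n > 0" "c > 0"
  shows "real_spectral_radius (c \<cdot>\<^sub>m A) = c * real_spectral_radius A"
proof (rule antisym)
  have "inverse c \<cdot>\<^sub>m (c \<cdot>\<^sub>m A) = A"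
    using assms by (intro eq_matI) auto
  then have "real_spectral_radius A \<le> inverse c * real_spectral_radius (c \<cdot>\<^sub>m A)"
    using real_spectral_radius_smult_le[of "c \<cdot>\<^sub>m A" n "inverse c"] assms by simp
  then show "c * real_spectral_radius A \<le> real_spectral_radius (c \<cdot>\<^sub>m A)"
    using assms(3) by (simp add: field_simps)
qed (rule real_spectral_radius_smult_le[OF assms])

section \<open>Collatz-Wielandt bounds for nonnegative matrices\<close>

lemma nonneg_mat_entry:
  assumes "nonneg_mat A" "A \<in> carrier_mat n n" "i < n" "j < n"
  shows "0 \<le> A $$ (i, j)"
  using assms by (auto simp: nonneg_mat_def)

lemma mat_act_mono:
  fixes x y :: "nat \<Rightarrow> real"
  assumes "nonneg_mat A" "A \<in> carrier_mat n n" "i < n" "\<And>j. j < n \<Longrightarrow> x j \<le> y j"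
  shows "mat_act n A x i \<le> mat_act n A y i"
  unfolding mat_act_def
  using assms by (intro sum_mono mult_left_mono nonneg_mat_entry[OF assms(1,2)]) auto

lemma mat_act_nonneg:
  fixes x :: "nat \<Rightarrow> real"
  assumes "nonneg_mat A" "A \<in> carrier_mat n n" "i < n" "\<And>j. j < n \<Longrightarrow> 0 \<le> x j"
  shows "0 \<le> mat_act n A x i"
  using mat_act_mono[OF assms(1,2,3), of "\<lambda>_. 0" x] assms(4) by (simp add: mat_act_def)

lemma mat_act_entry_le:
  fixes x :: "nat \<Rightarrow> real"
  assumes "nonneg_mat A" "A \<in> carrier_mat n n" "i < n" "j < n" "\<And>j. j < n \<Longrightarrow> 0 \<le> x j"
  shows "A $$ (i, j) * x j \<le> mat_act n A x i"
  unfolding mat_act_def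
  using assms by (intro member_le_sum) (auto intro!: mult_nonneg_nonneg nonneg_mat_entry[OF assms(1,2)])

lemma norm_mat_act_le:
  assumes "nonneg_mat A" "A \<in> carrier_mat n n" "i < n"
  shows "norm (mat_act n (cmat A) z i) \<le> mat_act n A (\<lambda>j. norm (z j)) i"
proof -
  have "norm (mat_act n (cmat A) z i) \<le> (\<Sum>j<n. norm (cmat A $$ (i, j) * z j))"
    unfolding mat_act_def by (rule norm_sum)
  also have "\<dots> = mat_act n A (\<lambda>j. norm (z j)) i"
    unfolding mat_act_def using assms
    by (intro sum.cong) (auto simp: norm_mult nonneg_mat_entry[OF assms(1,2)])
  finally show ?thesis .
qed

text \<open>Take an eigenvector \<open>z\<close> for an eigenvalue of maximal modulus and the least
  \<open>m\<close> for which \<open>m * x\<close> dominates the moduli of \<open>z\<close>. At an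
  index where the two touch, the eigenvalue equation and the hypothesis on \<open>x\<close> bound
  the eigenvalue by \<rho>.\<close>

lemma real_spectral_radius_le:
  assumes A: "nonneg_mat A" "A \<in> carrier_mat n n" and n: "n > 0"
    and x: "\<And>i. i < n \<Longrightarrow> 0 < x i" "\<And>i. i < n \<Longrightarrow> mat_act n A x i \<le> \<rho> * x i"
  shows "real_spectral_radius A \<le> \<rho>"
proof -
  obtain k where k: "eigenvalue (cmat A) k" "norm k = real_spectral_radius A"
    using real_spectral_radius_attained[OF A(2) n] .
  then obtain z where z: "\<exists>i<n. z i \<noteq> 0" "\<And>i. i < n \<Longrightarrow> mat_act n (cmat A) z i = k * z i"
    using eigenvalue_iff_mat_act[of "cmat A" n k] A(2) by auto
  define m where "m = Max ((\<lambda>i. norm (z i) / x i) ` {..<n})"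
  have le: "norm (z i) \<le> m * x i" if "i < n" for i
  proof -
    have "norm (z i) / x i \<le> m" unfolding m_def using that by (intro Max_ge) auto
    then show ?thesis using x(1)[OF that] by (simp add: field_simps)
  qed
  have "m \<in> (\<lambda>i. norm (z i) / x i) ` {..<n}"
    unfolding m_def using n by (intro Max_in) auto
  then obtain i where i: "i < n" "m = norm (z i) / x i" by auto
  have eq: "norm (z i) = m * x i" using i x(1)[OF i(1)] by simp
  have "m > 0"
  proof -
    obtain j where j: "j < n" "z j \<noteq> 0" using z(1) by auto
    then have "0 < m * x j" using le[OF j(1)] by (smt (verit) zero_less_norm_iff)
    then show ?thesis using x(1)[OF j(1)] by (simp add: zero_less_mult_iff)
  qed
  have "norm k * (m * x i) = norm (mat_act n (cmat A) z i)"
    using z(2)[OF i(1)] eq by (simp add: norm_mult)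
  also have "\<dots> \<le> mat_act n A (\<lambda>j. norm (z j)) i" by (rule norm_mat_act_le[OF A i(1)])
  also have "\<dots> \<le> mat_act n A (\<lambda>j. m * x j) i" using le by (intro mat_act_mono[OF A i(1)])
  also have "\<dots> = m * mat_act n A x i" by (simp add: mat_act_def sum_distrib_left algebra_simps)
  also have "\<dots> \<le> m * (\<rho> * x i)" using x(2)[OF i(1)] \<open>m > 0\<close> by simp
  finally have "norm k * (m * x i) \<le> \<rho> * (m * x i)" by (simp add: algebra_simps)
  then show ?thesis using k(2) \<open>m > 0\<close> x(1)[OF i(1)] by simp
qed

text \<open>Nonnegativity of the powers is part of the induction because the step applies the
  monotone map given by the \<open>k\<close>-th power to \<open>q * x \<le> A x\<close>.\<close>

lemma mat_act_pow_ge: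
  fixes x :: "nat \<Rightarrow> real"
  assumes A: "nonneg_mat A" "A \<in> carrier_mat n n" and "0 \<le> q"
    and x: "\<And>i. i < n \<Longrightarrow> 0 \<le> x i" "\<And>i. i < n \<Longrightarrow> q * x i \<le> mat_act n A x i"
  shows "nonneg_mat (A ^\<^sub>m k) \<and> (\<forall>i<n. q ^ k * x i \<le> mat_act n (A ^\<^sub>m k) x i)"
proof (induction k)
  case 0
  have "mat_act n (1\<^sub>m n) x i = x i" if "i < n" for i
    using that by (simp add: mat_act_def if_distrib[of "\<lambda>u. u * _"] cong: if_cong)
  then show ?case using A(2) by (auto simp: nonneg_mat_def one_mat_def)
next
  case (Suc k)
  have P: "A ^\<^sub>m k \<in> carrier_mat n n" using A(2) by simp
  have entry: "(A ^\<^sub>m Suc k) $$ (i, j) = (\<Sum>l<n. (A ^\<^sub>m k) $$ (i, l) * A $$ (l, j))"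
    if "i < n" "j < n" for i j
    using that A(2) P by (auto simp: scalar_prod_def atLeast0LessThan)
  have nn: "nonneg_mat (A ^\<^sub>m Suc k)"
    unfolding nonneg_mat_def using A(2) P Suc
    by (auto simp: entry simp del: pow_mat.simps(2)
        intro!: sum_nonneg mult_nonneg_nonneg nonneg_mat_entry[OF A] nonneg_mat_entry[OF _ P])
  have "q ^ Suc k * x i \<le> mat_act n (A ^\<^sub>m Suc k) x i" if i: "i < n" for i
  proof -
    have "q ^ Suc k * x i = q * (q ^ k * x i)" by simp
    also have "\<dots> \<le> q * mat_act n (A ^\<^sub>m k) x i" using Suc i assms(3) by (intro mult_left_mono) auto
    also have "\<dots> = mat_act n (A ^\<^sub>m k) (\<lambda>j. q * x j) i"
      by (simp add: mat_act_def sum_distrib_left algebra_simps)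
    also have "\<dots> \<le> mat_act n (A ^\<^sub>m k) (mat_act n A x) i"
      using Suc x(2) by (intro mat_act_mono[OF _ P i]) auto
    also have "\<dots> = (\<Sum>l<n. \<Sum>j<n. (A ^\<^sub>m k) $$ (i, l) * A $$ (l, j) * x j)"
      by (simp add: mat_act_def sum_distrib_left mult.assoc)
    also have "\<dots> = (\<Sum>j<n. \<Sum>l<n. (A ^\<^sub>m k) $$ (i, l) * A $$ (l, j) * x j)"
      by (rule sum.swap)
    also have "\<dots> = mat_act n (A ^\<^sub>m Suc k) x i"
      unfolding mat_act_def by (rule sum.cong) (auto simp only: entry i lessThan_iff sum_distrib_right)
    finally show ?thesis .
  qed
  then show ?case using nn by blast
qed

text \<open>If \<open>real_spectral_radius A < \<rho>\<close>, the powers of a suitable multiple of \<open>A\<close> stay bounded, while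
  applied to \<open>x\<close> they grow geometrically.\<close>

lemma real_spectral_radius_ge:
  assumes A: "nonneg_mat A" "A \<in> carrier_mat n n"
    and x: "\<And>i. i < n \<Longrightarrow> 0 \<le> x i" "m < n" "0 < x m"
    and ge: "\<And>i. i < n \<Longrightarrow> \<rho> * x i \<le> mat_act n A x i"
  shows "\<rho> \<le> real_spectral_radius A"
proof (rule ccontr)
  assume "\<not> ?thesis"
  \<comment> \<open>Dividing \<open>A\<close> by a number strictly in between brings the spectral
    radius below 1 but keeps the growth factor \<open>q\<close> on \<open>x\<close> above 1.\<close>
  then obtain \<sigma> where \<sigma>: "real_spectral_radius A < \<sigma>" "\<sigma> < \<rho>" by (meson dense not_le)
  have n: "n > 0" using x(2) by simp
  have "\<sigma> > 0" using real_spectral_radius_nonneg[OF A(2) n] \<sigma>(1) by simp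
  define B where "B = inverse \<sigma> \<cdot>\<^sub>m A"
  define q where "q = \<rho> / \<sigma>"
  have B: "B \<in> carrier_mat n n" "nonneg_mat B"
    using A \<open>\<sigma> > 0\<close> by (auto simp: B_def nonneg_mat_def)
  have q: "q > 1" using \<sigma> \<open>\<sigma> > 0\<close> by (simp add: q_def)
  have "real_spectral_radius B = real_spectral_radius A / \<sigma>"
    unfolding B_def using real_spectral_radius_smult[OF A(2) n] \<open>\<sigma> > 0\<close>
    by (simp add: divide_inverse mult.commute)
  then have "real_spectral_radius B < 1"
    using \<sigma>(1) \<open>\<sigma> > 0\<close> by simp
  then obtain c where c: "\<And>k. norm_bound (cmat B ^\<^sub>m k) c"
    using spectral_radius_jnf_norm_bound_less_1_upper_triangular[of "cmat B" n] B(1)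
    unfolding real_spectral_radius_def by auto
  have bound: "(B ^\<^sub>m k) $$ (i, j) \<le> c" if "i < n" "j < n" for i j k
  proof -
    have "cmat B ^\<^sub>m k = cmat (B ^\<^sub>m k)"
      using of_real_hom.mat_hom_pow[OF B(1)] by metis
    then have "norm (cmat (B ^\<^sub>m k) $$ (i, j)) \<le> c"
      using c[of k] that B(1) by (auto simp: norm_bound_def)
    then show ?thesis using that B(1) by simp
  qed
  have "q * x i \<le> mat_act n B x i" if "i < n" for i
  proof -
    have "mat_act n B x i = inverse \<sigma> * mat_act n A x i"
      using that A(2) by (simp add: B_def mat_act_def sum_distrib_left mult.assoc)
    then show ?thesis using ge[OF that] \<open>\<sigma> > 0\<close> by (simp add: q_def field_simps)
  qed
  then have grow: "q ^ k * x m \<le> mat_act n (B ^\<^sub>m k) x m" for k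
    using mat_act_pow_ge[OF B(2,1), of q x k] q x by auto
  have "q ^ k * x m \<le> c * sum x {..<n}" for k
  proof -
    have "mat_act n (B ^\<^sub>m k) x m \<le> (\<Sum>j<n. c * x j)"
      unfolding mat_act_def using x bound by (intro sum_mono mult_right_mono) auto
    then show ?thesis using grow[of k] by (simp add: sum_distrib_left)
  qed
  moreover obtain k where "c * sum x {..<n} / x m < q ^ k"
    using real_arch_pow[OF q] by blast
  ultimately show False using x(3) by (simp add: field_simps not_le[symmetric])
qed

lemma real_spectral_radius_eqI:
  assumes A: "nonneg_mat A" "A \<in> carrier_mat n n" and n: "n > 0"
    and x: "\<And>i. i < n \<Longrightarrow> 0 < x i" "\<And>i. i < n \<Longrightarrow> mat_act n A x i = \<rho> * x i"
  shows "real_spectral_radius A = \<rho>"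
  using real_spectral_radius_le[OF A n, of x \<rho>] real_spectral_radius_ge[OF A, of x 0 \<rho>] n x
  by (force intro: antisym less_imp_le)

section \<open>Perron vectors of irreducible matrices\<close>

text \<open>Irreducibility as it is used throughout: a property that holds at some indices and fails
  at others is left along a nonzero entry. The partition is into the indices with and without
  \<open>P\<close>.\<close>

lemma irreducible_matD:
  assumes "irreducible_mat n A" "i < n" "P i" "j < n" "\<not> P j"
  shows "\<exists>i<n. \<exists>j<n. P i \<and> \<not> P j \<and> A $$ (i, j) \<noteq> 0"
proof (rule ccontr)
  define S1 where "S1 = {i. i < n \<and> P i}"
  define S2 where "S2 = {i. i < n \<and> \<not> P i}"
  assume "\<not> ?thesis"
  then have "\<forall>i\<in>S1. \<forall>j\<in>S2. A $$ (i, j) = 0"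
    by (auto simp: S1_def S2_def)
  moreover have "S1 \<noteq> {}" "S2 \<noteq> {}" "S1 \<inter> S2 = {}" "S1 \<union> S2 = {0..<n}"
    using assms(2-) by (auto simp: S1_def S2_def)
  ultimately have "\<not> irreducible_mat n A"
    unfolding irreducible_mat_def not_not by (intro exI[of _ S1] exI[of _ S2] conjI)
  then show False using assms(1) by simp
qed

text \<open>The map \<open>I + A\<close>. For nonnegative \<open>A\<close> and nonnegative vectors,
  iterating it only enlarges the support, which iterating \<open>A\<close> alone does not
  guarantee.\<close>

definition id_plus_act :: "nat \<Rightarrow> real mat \<Rightarrow> (nat \<Rightarrow> real) \<Rightarrow> nat \<Rightarrow> real" where
  "id_plus_act n A y i = y i + mat_act n A y i"

lemma id_plus_act_Suc:
  "(id_plus_act n A ^^ Suc k) y i =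
    (id_plus_act n A ^^ k) y i + mat_act n A ((id_plus_act n A ^^ k) y) i"
  by (simp only: funpow.simps o_apply id_plus_act_def)

lemma id_plus_act_ge:
  assumes "nonneg_mat A" "A \<in> carrier_mat n n" "\<And>i. i < n \<Longrightarrow> 0 \<le> y i"
  shows "i < n \<Longrightarrow> y i \<le> (id_plus_act n A ^^ k) y i"
proof (induction k arbitrary: i)
  case (Suc k)
  have "0 \<le> (id_plus_act n A ^^ k) y j" if "j < n" for j
    using Suc.IH[OF that] assms(3)[OF that] by linarith
  then have "0 \<le> mat_act n A ((id_plus_act n A ^^ k) y) i"
    using mat_act_nonneg[OF assms(1,2) Suc.prems] by blast
  then show ?case using Suc unfolding id_plus_act_Suc by fastforce
qed simp

text \<open>Induction on the number of zero entries: irreducibility yields a nonzero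
  \<open>A $$ (i, j)\<close> with \<open>y i = 0\<close> and \<open>y j > 0\<close>, so one
  application fills entry \<open>i\<close> and keeps every positive entry positive.\<close>

lemma id_plus_act_positive:
  assumes A: "nonneg_mat A" "A \<in> carrier_mat n n" and irr: "irreducible_mat n A"
  shows "(\<And>i. i < n \<Longrightarrow> 0 \<le> y i) \<Longrightarrow> \<exists>i<n. 0 < y i \<Longrightarrow> \<exists>k. \<forall>i<n. 0 < (id_plus_act n A ^^ k) y i"
proof (induction "card {i. i < n \<and> y i = 0}" arbitrary: y rule: less_induct)
  case less
  show ?case
  proof (cases "\<exists>i<n. y i = 0")
    case False
    then have "\<forall>i<n. 0 < (id_plus_act n A ^^ 0) y i"
      using less.prems(1) by (simp add: order_less_le) metis
    then show ?thesis by blast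
  next
    case True
    then obtain a where "a < n" "y a = 0" by blast
    moreover obtain b where "b < n" "\<not> y b = 0" using less.prems(2) by auto
    ultimately obtain i j where ij: "i < n" "j < n" "y i = 0" "\<not> y j = 0" "A $$ (i, j) \<noteq> 0"
      using irreducible_matD[OF irr, of a "\<lambda>i. y i = 0" b] by metis
    define y' where "y' = id_plus_act n A y"
    have ge: "y l \<le> y' l" if "l < n" for l
      using id_plus_act_ge[OF A less.prems(1) that, where k = 1] by (simp add: y'_def)
    have "0 < A $$ (i, j) * y j"
      using ij less.prems(1)[OF ij(2)] nonneg_mat_entry[OF A ij(1,2)] by simp
    then have "0 < y' i"
      using mat_act_entry_le[OF A ij(1,2), of y] less.prems(1) ij(3)
      by (simp add: y'_def id_plus_act_def)
    have sub: "{l. l < n \<and> y' l = 0} \<subset> {l. l < n \<and> y l = 0}"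
    proof
      show "{l. l < n \<and> y' l = 0} \<subseteq> {l. l < n \<and> y l = 0}"
        using ge less.prems(1) by (force intro: antisym)
      show "{l. l < n \<and> y' l = 0} \<noteq> {l. l < n \<and> y l = 0}"
        using ij(1,3) \<open>0 < y' i\<close> by (metis (mono_tags, lifting) less_irrefl mem_Collect_eq)
    qed
    have "card {l. l < n \<and> y' l = 0} < card {l. l < n \<and> y l = 0}"
      using sub by (intro psubset_card_mono) auto
    moreover have "0 \<le> y' l" if "l < n" for l
      using ge[OF that] less.prems(1)[OF that] by linarith
    moreover have "\<exists>i<n. 0 < y' i" using \<open>0 < y' i\<close> ij(1) by blast
    ultimately obtain k where "\<forall>i<n. 0 < (id_plus_act n A ^^ k) y' i"
      using less.hyps by blast
    then have "\<forall>i<n. 0 < (id_plus_act n A ^^ Suc k) y i"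
      by (simp add: y'_def funpow_swap1)
    then show ?thesis by blast
  qed
qed

text \<open>\<open>I + A\<close> commutes with \<open>A - \<rho> I\<close>. Positivity of iterates
  can therefore be applied to the residual of an approximate eigenvector.\<close>

lemma id_plus_act_residual:
  "mat_act n A ((id_plus_act n A ^^ k) y) i - \<rho> * (id_plus_act n A ^^ k) y i =
    (id_plus_act n A ^^ k) (\<lambda>i. mat_act n A y i - \<rho> * y i) i"
proof (induction k arbitrary: i)
  case (Suc k)
  let ?x = "(id_plus_act n A ^^ k) y"
  have IH: "(id_plus_act n A ^^ k) (\<lambda>i. mat_act n A y i - \<rho> * y i) = (\<lambda>i. mat_act n A ?x i - \<rho> * ?x i)"
    using Suc by auto
  show ?case
    unfolding id_plus_act_Suc IH
    by (simp add: mat_act_def algebra_simps sum.distrib sum_distrib_left sum_subtractf)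
qed simp

lemma id_plus_act_uminus:
  "(id_plus_act n A ^^ k) (\<lambda>i. - y i) = (\<lambda>i. - (id_plus_act n A ^^ k) y i)"
proof (induction k)
  case (Suc k)
  show ?case
    by (rule ext, unfold id_plus_act_Suc Suc) (simp add: mat_act_def sum_negf)
qed simp

text \<open>Each of the finitely many inequalities holds for all small positive \<open>e\<close>.
  This turns a strictly one-signed residual into a shift of \<rho> by \<open>e\<close>.\<close>

lemma finite_positive_margin:
  fixes d y :: "nat \<Rightarrow> real"
  assumes "\<And>i. i < n \<Longrightarrow> 0 < d i"
  obtains e where "0 < e" "\<And>i. i < n \<Longrightarrow> e * y i \<le> d i"
proof -
  have "\<forall>\<^sub>F e in at_right 0. e * y i \<le> d i" if "i < n" for i
  proof -
    have "((\<lambda>e. e * y i) \<longlongrightarrow> 0 * y i) (at_right 0)" by (intro tendsto_intros)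
    then have "\<forall>\<^sub>F e in at_right 0. e * y i < d i"
      using assms[OF that] by (intro order_tendstoD) auto
    then show ?thesis by (rule eventually_mono) auto
  qed
  then have "\<forall>\<^sub>F e in at_right 0. \<forall>i\<in>{..<n}. e * y i \<le> d i"
    by (intro eventually_ball_finite) auto
  then have "\<forall>\<^sub>F e in at_right 0. 0 < e \<and> (\<forall>i\<in>{..<n}. e * y i \<le> d i)"
    using eventually_at_right_less[of "0::real"] by eventually_elim auto
  then obtain e where "0 < e" "\<forall>i\<in>{..<n}. e * y i \<le> d i"
    using eventually_happens'[OF trivial_limit_at_right_real] by blast
  then show ?thesis using that by auto
qed

text \<open>In the next two lemmas, applying a power of \<open>I + A\<close> to a vector with a one-signed, nonzero residual
  \<open>A x - \<rho> x\<close> makes the residual strictly one-signed, so \<open>\<rho>\<close> can be improved.\<close>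

lemma sub_eigenvector_imp_eigenvector:
  assumes A: "nonneg_mat A" "A \<in> carrier_mat n n" and irr: "irreducible_mat n A"
    and x: "\<And>i. i < n \<Longrightarrow> 0 \<le> x i" "m < n" "0 < x m"
    and ge: "\<And>i. i < n \<Longrightarrow> real_spectral_radius A * x i \<le> mat_act n A x i"
  shows "i < n \<Longrightarrow> mat_act n A x i = real_spectral_radius A * x i"
proof (rule ccontr)
  let ?r = "real_spectral_radius A"
  let ?d = "\<lambda>i. mat_act n A x i - ?r * x i"
  assume "i < n" "mat_act n A x i \<noteq> ?r * x i"
  then have "\<exists>i<n. 0 < ?d i" using ge[of i] by force
  then obtain k where k: "\<forall>i<n. 0 < (id_plus_act n A ^^ k) ?d i"
    using id_plus_act_positive[OF A irr, of ?d] ge by auto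
  define y where "y = (id_plus_act n A ^^ k) x"
  have y: "x i \<le> y i" if "i < n" for i
    using id_plus_act_ge[OF A x(1) that] by (simp add: y_def)
  obtain e where e: "0 < e" "\<And>i. i < n \<Longrightarrow> e * y i \<le> mat_act n A y i - ?r * y i"
    using finite_positive_margin[of n "\<lambda>i. mat_act n A y i - ?r * y i" y] k
    unfolding y_def id_plus_act_residual by blast
  have "?r + e \<le> ?r"
  proof (rule real_spectral_radius_ge[OF A _ x(2)])
    show "0 \<le> y i" if "i < n" for i using y[OF that] x(1)[OF that] by linarith
    show "0 < y m" using y[OF x(2)] x(3) by linarith
    show "(?r + e) * y i \<le> mat_act n A y i" if "i < n" for i
      using e(2)[OF that] by (simp add: algebra_simps)
  qed
  then show False using e(1) by simp
qed

lemma super_eigenvector_imp_eigenvector: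
  assumes A: "nonneg_mat A" "A \<in> carrier_mat n n" and irr: "irreducible_mat n A"
    and x: "\<And>i. i < n \<Longrightarrow> 0 < x i"
    and le: "\<And>i. i < n \<Longrightarrow> mat_act n A x i \<le> real_spectral_radius A * x i"
  shows "i < n \<Longrightarrow> mat_act n A x i = real_spectral_radius A * x i"
proof (rule ccontr)
  let ?r = "real_spectral_radius A"
  let ?d = "\<lambda>i. mat_act n A x i - ?r * x i"
  assume i: "i < n" "mat_act n A x i \<noteq> ?r * x i"
  then have n: "n > 0" by simp
  have "\<exists>i<n. 0 < - ?d i" using le[of i] i by force
  then obtain k where k: "\<forall>i<n. 0 < (id_plus_act n A ^^ k) (\<lambda>i. - ?d i) i"
    using id_plus_act_positive[OF A irr, of "\<lambda>i. - ?d i"] le by auto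
  define y where "y = (id_plus_act n A ^^ k) x"
  have y: "0 < y i" if "i < n" for i
    using id_plus_act_ge[OF A, where y = x and i = i and k = k] x that unfolding y_def
    by (meson less_imp_le order_less_le_trans)
  have "0 < - (mat_act n A y i - ?r * y i)" if "i < n" for i
    using k that unfolding y_def id_plus_act_residual id_plus_act_uminus by blast
  then obtain e where e: "0 < e" "\<And>i. i < n \<Longrightarrow> e * y i \<le> - (mat_act n A y i - ?r * y i)"
    using finite_positive_margin[of n "\<lambda>i. - (mat_act n A y i - ?r * y i)" y] by blast
  have "?r \<le> ?r - e"
  proof (rule real_spectral_radius_le[OF A n y])
    show "mat_act n A y i \<le> (?r - e) * y i" if "i < n" for i
      using e(2)[OF that] by (simp add: algebra_simps)
  qed
  then show False using e(1) by simp
qed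

text \<open>By the triangle inequality the moduli of an eigenvector for an eigenvalue of maximal
  modulus form a sub-eigenvector, hence an eigenvector. If it had a zero entry, irreducibility would
  provide a row with zero entry that receives a positive contribution.\<close>

lemma perron_vector:
  assumes A: "nonneg_mat A" "A \<in> carrier_mat n n" and irr: "irreducible_mat n A" and n: "n > 0"
  obtains x where "\<And>i. i < n \<Longrightarrow> 0 < x i"
    "\<And>i. i < n \<Longrightarrow> mat_act n A x i = real_spectral_radius A * x i"
proof -
  let ?r = "real_spectral_radius A"
  obtain k where k: "eigenvalue (cmat A) k" "norm k = ?r"
    using real_spectral_radius_attained[OF A(2) n] .
  then obtain z m where z: "m < n" "z m \<noteq> 0" "\<And>i. i < n \<Longrightarrow> mat_act n (cmat A) z i = k * z i"
    using eigenvalue_iff_mat_act[of "cmat A" n k] A(2) by auto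
  define x where "x i = norm (z i)" for i
  have x: "0 \<le> x i" "0 < x m" for i using z(2) by (auto simp: x_def)
  have "?r * x i \<le> mat_act n A x i" if "i < n" for i
    using norm_mat_act_le[OF A that, of z] z(3)[OF that] k(2) by (simp add: x_def[abs_def] norm_mult)
  then have eig: "mat_act n A x i = ?r * x i" if "i < n" for i
    using sub_eigenvector_imp_eigenvector[OF A irr, where x = x and m = m and i = i] x z(1) that by blast
  have "0 < x i" if i: "i < n" for i
  proof (rule ccontr)
    assume "\<not> 0 < x i"
    then have "x i = 0" using x(1)[of i] by linarith
    moreover have "\<not> x m = 0" using x(2) by linarith
    ultimately obtain a b where ab: "a < n" "b < n" "x a = 0" "\<not> x b = 0" "A $$ (a, b) \<noteq> 0"
      using irreducible_matD[OF irr, of i "\<lambda>i. x i = 0" m] i z(1) by metis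
    then have "0 < A $$ (a, b) * x b"
      using x(1)[of b] nonneg_mat_entry[OF A ab(1,2)] by simp
    then have "0 < mat_act n A x a" using mat_act_entry_le[OF A ab(1,2), of x] x(1) by fastforce
    then show False using eig[OF ab(1)] ab(3) by simp
  qed
  then show ?thesis using eig that by blast
qed

text \<open>The 1 x 1 zero matrix is irreducible, hence the bound on \<open>n\<close>. From 2 on,
  irreducibility supplies a nonzero entry, and its row in the Perron equation is positive.\<close>

lemma real_spectral_radius_pos:
  assumes A: "nonneg_mat A" "A \<in> carrier_mat n n" and irr: "irreducible_mat n A" and n: "n \<ge> 2"
  shows "0 < real_spectral_radius A"
proof -
  have n0: "n > 0" using n by simp
  obtain x where x: "\<And>i. i < n \<Longrightarrow> 0 < x i"
    "\<And>i. i < n \<Longrightarrow> mat_act n A x i = real_spectral_radius A * x i"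
    using perron_vector[OF A irr n0] by blast
  obtain i j where ij: "i < n" "j < n" "A $$ (i, j) \<noteq> 0"
    using irreducible_matD[OF irr n0, of "\<lambda>i. i = 0" 1] n by force
  then have "0 < A $$ (i, j) * x j"
    using x(1)[OF ij(2)] nonneg_mat_entry[OF A ij(1,2)] by simp
  then have "0 < mat_act n A x i" using mat_act_entry_le[OF A ij(1,2), of x] x(1) by fastforce
  then show ?thesis using x(1)[OF ij(1)] x(2)[OF ij(1)] by (simp add: zero_less_mult_iff)
qed

section \<open>Property 1 in terms of row scalings\<close>

text \<open>This is \<open>mat_exp D * A\<close> with \<open>D\<close> encoded by its diagonal
  \<open>d\<close>, so that convex combinations of diagonal matrices become combinations of
  functions.\<close>

definition scale_rows :: "nat \<Rightarrow> (nat \<Rightarrow> real) \<Rightarrow> real mat \<Rightarrow> real mat" where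
  "scale_rows n d A = mat n n (\<lambda>(i, j). exp (d i) * A $$ (i, j))"

lemma scale_rows_simps [simp]:
  "scale_rows n d A \<in> carrier_mat n n"
  "i < n \<Longrightarrow> j < n \<Longrightarrow> scale_rows n d A $$ (i, j) = exp (d i) * A $$ (i, j)"
  by (auto simp: scale_rows_def)

lemma nonneg_scale_rows:
  assumes "nonneg_mat A" "A \<in> carrier_mat n n"
  shows "nonneg_mat (scale_rows n d A)"
  using nonneg_mat_entry[OF assms] by (auto simp: nonneg_mat_def scale_rows_def)

lemma irreducible_scale_rows:
  "irreducible_mat n (scale_rows n d A) \<longleftrightarrow> irreducible_mat n A"
proof -
  have *: "(\<forall>i\<in>S1. \<forall>j\<in>S2. scale_rows n d A $$ (i, j) = 0) \<longleftrightarrow> (\<forall>i\<in>S1. \<forall>j\<in>S2. A $$ (i, j) = 0)"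
    if "S1 \<union> S2 = {0..<n}" for S1 S2
  proof -
    have "i < n" if "i \<in> S1 \<union> S2" for i using that \<open>S1 \<union> S2 = {0..<n}\<close> by simp
    then show ?thesis by simp
  qed
  show ?thesis unfolding irreducible_mat_def by (simp only: * cong: conj_cong)
qed

lemma mat_act_scale_rows:
  "i < n \<Longrightarrow> mat_act n (scale_rows n d A) x i = exp (d i) * mat_act n A x i"
  by (simp add: mat_act_def sum_distrib_left mult.assoc)

lemma mat_diag_in_real_diagonal_mats: "mat_diag n d \<in> real_diagonal_mats n"
  by (auto simp: real_diagonal_mats_def diagonal_mat_def mat_diag_def)

lemma real_diagonal_mats_eq_mat_diag:
  "D \<in> real_diagonal_mats n \<Longrightarrow> D = mat_diag n (\<lambda>i. D $$ (i, i))"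
  unfolding real_diagonal_mats_def diagonal_mat_def mat_diag_def by (auto intro!: eq_matI)

lemma mat_exp_mat_diag_mult:
  assumes "A \<in> carrier_mat n n"
  shows "mat_exp (mat_diag n d) * A = scale_rows n d A"
proof -
  have "mat_exp (mat_diag n d) = mat_diag n (\<lambda>i. exp (d i))"
    unfolding mat_exp_diagonal[OF mat_diag_in_real_diagonal_mats]
    by (auto simp: mat_diag_def intro!: eq_matI)
  then show ?thesis
    using assms by (simp add: mat_diag_mult_left scale_rows_def)
qed

text \<open>Every real diagonal matrix is a \<open>mat_diag\<close>, so the quantifiers can range
  over functions instead.\<close>

lemma property1_iff:
  assumes A: "A \<in> carrier_mat n n"
  defines "R \<equiv> \<lambda>d. ln (real_spectral_radius (scale_rows n d A))"
  shows "property1 n A \<longleftrightarrow>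
    (\<forall>c d. (\<exists>t\<in>{0<..<1}. R (\<lambda>i. (1 - t) * c i + t * d i) = (1 - t) * R c + t * R d)
      \<longrightarrow> (\<exists>k. \<forall>i<n. c i - d i = k))"
proof -
  have comb: "(1 - t) \<cdot>\<^sub>m mat_diag n c + t \<cdot>\<^sub>m mat_diag n d = mat_diag n (\<lambda>i. (1 - t) * c i + t * d i)"
    for t :: real and c d
    by (auto simp: mat_diag_def intro!: eq_matI)
  have scalar: "mat_diag n c - mat_diag n d = k \<cdot>\<^sub>m 1\<^sub>m n \<longleftrightarrow> (\<forall>i<n. c i - d i = k)"
    for c d and k :: real
    by (auto simp: mat_diag_def mat_eq_iff one_mat_def)
  have "property1 n A \<longleftrightarrow> (\<forall>c d.
      (\<exists>t\<in>{0<..<1}. ln (real_spectral_radius (mat_exp ((1 - t) \<cdot>\<^sub>m mat_diag n c + t \<cdot>\<^sub>m mat_diag n d) * A)) =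
         (1 - t) * ln (real_spectral_radius (mat_exp (mat_diag n c) * A))
         + t * ln (real_spectral_radius (mat_exp (mat_diag n d) * A)))
      \<longrightarrow> (\<exists>k. mat_diag n c - mat_diag n d = k \<cdot>\<^sub>m 1\<^sub>m n))"
  proof -
    have "(\<forall>C\<in>real_diagonal_mats n. \<forall>D\<in>real_diagonal_mats n. P C D) \<longleftrightarrow>
        (\<forall>c d. P (mat_diag n c) (mat_diag n d))" for P
      using mat_diag_in_real_diagonal_mats real_diagonal_mats_eq_mat_diag by metis
    then show ?thesis unfolding property1_def .
  qed
  then show ?thesis
    by (simp only: comb scalar mat_exp_mat_diag_mult[OF A] R_def)
qed

section \<open>Sufficiency\<close>

text \<open>Apply \<open>ln z \<le> z - 1\<close> to \<open>x / m\<close> and \<open>y / m\<close>,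
  where \<open>m\<close> is the arithmetic mean: the weighted right-hand sides cancel. Equality
  forces equality in both instances, so both quotients are 1.\<close>

lemma weighted_am_gm:
  fixes x y t :: real
  assumes "0 < x" "0 < y" "0 < t" "t < 1"
  shows "x powr (1 - t) * y powr t \<le> (1 - t) * x + t * y"
    and "x powr (1 - t) * y powr t = (1 - t) * x + t * y \<Longrightarrow> x = y"
proof -
  define m where "m = (1 - t) * x + t * y"
  have m: "0 < m" unfolding m_def using assms by (intro add_pos_pos mult_pos_pos) auto
  have ln_gm: "ln (x powr (1 - t) * y powr t) = (1 - t) * ln x + t * ln y"
    using assms by (simp add: ln_mult ln_powr)
  have ln_div_m: "ln (x / m) = ln x - ln m" "ln (y / m) = ln y - ln m"
    using assms m by (simp_all add: ln_div)
  have le: "ln (x / m) \<le> x / m - 1" "ln (y / m) \<le> y / m - 1"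
    using assms m by (simp_all add: ln_le_minus_one)
  have zero: "(1 - t) * (x / m - 1) + t * (y / m - 1) = 0"
  proof -
    have "(1 - t) * (x / m - 1) + t * (y / m - 1) = ((1 - t) * x + t * y) / m - 1"
      by (simp add: algebra_simps add_divide_distrib diff_divide_distrib)
    then show ?thesis using m by (simp add: m_def[symmetric])
  qed
  have le': "(1 - t) * ln (x / m) \<le> (1 - t) * (x / m - 1)" "t * ln (y / m) \<le> t * (y / m - 1)"
    using le assms by (simp_all add: mult_left_mono)
  have split: "(1 - t) * ln x + t * ln y = (1 - t) * ln (x / m) + t * ln (y / m) + ln m"
    unfolding ln_div_m by (simp add: algebra_simps)
  have "ln (x powr (1 - t) * y powr t) \<le> ln m"
    unfolding ln_gm split using le' zero by linarith
  then show "x powr (1 - t) * y powr t \<le> (1 - t) * x + t * y"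
    using m assms by (subst (asm) ln_le_cancel_iff) (auto simp: m_def)
  assume eq: "x powr (1 - t) * y powr t = (1 - t) * x + t * y"
  have "(1 - t) * ln (x / m) + t * ln (y / m) = 0"
    using ln_gm unfolding eq m_def[symmetric] split by simp
  then have "(1 - t) * ln (x / m) = (1 - t) * (x / m - 1)" "t * ln (y / m) = t * (y / m - 1)"
    using le' zero by linarith+
  then have "ln (x / m) = x / m - 1" "ln (y / m) = y / m - 1" using assms by simp_all
  then have "x / m = 1" "y / m = 1"
    using ln_eq_minus_one[of "x / m"] ln_eq_minus_one[of "y / m"] m assms
    by (simp_all del: divide_eq_1_iff)
  then show "x = y" using m by simp
qed

text \<open>Normalising by \<open>U\<close> and \<open>V\<close> reduces the claim to the weighted
  AM-GM inequality in each summand, the arithmetic means \<open>h\<close> having total weight 1. If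
  the sums agree, so do the summands, and the equality case of AM-GM applies wherever
  \<open>p j\<close> is nonzero.\<close>

lemma weighted_hoelder:
  fixes p u v :: "'a \<Rightarrow> real"
  assumes J: "finite J" and p: "\<And>j. j \<in> J \<Longrightarrow> 0 \<le> p j"
    and uv: "\<And>j. j \<in> J \<Longrightarrow> 0 < u j" "\<And>j. j \<in> J \<Longrightarrow> 0 < v j"
    and t: "0 < t" "t < 1"
    and U: "U = (\<Sum>j\<in>J. p j * u j)" "0 < U" and V: "V = (\<Sum>j\<in>J. p j * v j)" "0 < V"
  shows "(\<Sum>j\<in>J. p j * (u j powr (1 - t) * v j powr t)) \<le> U powr (1 - t) * V powr t"
    and "(\<Sum>j\<in>J. p j * (u j powr (1 - t) * v j powr t)) = U powr (1 - t) * V powr t \<Longrightarrow>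
      j \<in> J \<Longrightarrow> p j \<noteq> 0 \<Longrightarrow> u j / U = v j / V"
proof -
  define g where "g j = (u j / U) powr (1 - t) * (v j / V) powr t" for j
  define h where "h j = (1 - t) * (u j / U) + t * (v j / V)" for j
  have UV: "0 < U powr (1 - t) * V powr t" using U V by simp
  have lhs: "(\<Sum>j\<in>J. p j * (u j powr (1 - t) * v j powr t)) = U powr (1 - t) * V powr t * (\<Sum>j\<in>J. p j * g j)"
    unfolding sum_distrib_left
  proof (rule sum.cong)
    fix j assume "j \<in> J"
    then show "p j * (u j powr (1 - t) * v j powr t) = U powr (1 - t) * V powr t * (p j * g j)"
      using uv[of j] U V by (simp add: g_def powr_divide)
  qed simp
  have "(\<Sum>j\<in>J. p j * h j) = (\<Sum>j\<in>J. (1 - t) / U * (p j * u j) + t / V * (p j * v j))"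
    by (rule sum.cong) (simp_all add: h_def field_simps)
  also have "\<dots> = (1 - t) / U * U + t / V * V"
    unfolding sum.distrib sum_distrib_left[symmetric] U(1)[symmetric] V(1)[symmetric] ..
  finally have h: "(\<Sum>j\<in>J. p j * h j) = 1" using U(2) V(2) by simp
  have le: "p j * g j \<le> p j * h j" if "j \<in> J" for j
    unfolding g_def h_def using that uv[OF that] p[OF that] U(2) V(2) t
    by (intro mult_left_mono weighted_am_gm(1)) auto
  then have "(\<Sum>j\<in>J. p j * g j) \<le> 1" unfolding h[symmetric] by (rule sum_mono)
  then show "(\<Sum>j\<in>J. p j * (u j powr (1 - t) * v j powr t)) \<le> U powr (1 - t) * V powr t"
    unfolding lhs using UV by (simp only: mult_left_le less_imp_le)
  assume eq: "(\<Sum>j\<in>J. p j * (u j powr (1 - t) * v j powr t)) = U powr (1 - t) * V powr t"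
    and j: "j \<in> J" "p j \<noteq> 0"
  have "(\<Sum>j\<in>J. p j * g j) = (\<Sum>j\<in>J. p j * h j)"
    using eq UV U(2) V(2) unfolding lhs h by simp
  then have "p j * g j = p j * h j"
    by (rule sum_mono_inv[OF _ le j(1) J])
  then have "g j = h j" using j(2) by simp
  then show "u j / U = v j / V"
    using weighted_am_gm(2)[of "u j / U" "v j / V" t] uv[OF j(1)] U(2) V(2) t
    by (simp add: g_def h_def)
qed

text \<open>Two indices in the support of a common row of \<open>A\<close> are adjacent in the graph of \<open>A\<^sup>T * A\<close>.\<close>

lemma irreducible_gram_imp_constant:
  assumes A: "A \<in> carrier_mat n n" and irr: "irreducible_mat n (A\<^sup>T * A)"
    and row: "\<And>i j k. i < n \<Longrightarrow> j < n \<Longrightarrow> k < n \<Longrightarrow> A $$ (i, j) \<noteq> 0 \<Longrightarrow> A $$ (i, k) \<noteq> 0 \<Longrightarrow> \<phi> j = \<phi> k"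
    and "a < n" "b < n"
  shows "\<phi> a = \<phi> b"
proof (rule ccontr)
  assume "\<phi> a \<noteq> \<phi> b"
  then obtain j k where jk: "j < n" "k < n" "\<phi> j = \<phi> a" "\<phi> k \<noteq> \<phi> a" "(A\<^sup>T * A) $$ (j, k) \<noteq> 0"
    using irreducible_matD[OF irr, of a "\<lambda>j. \<phi> j = \<phi> a" b] assms(4,5) by metis
  have "(A\<^sup>T * A) $$ (j, k) = (\<Sum>i<n. A $$ (i, j) * A $$ (i, k))"
    using A jk(1,2) by (auto simp: scalar_prod_def atLeast0LessThan)
  then obtain i where "i < n" "A $$ (i, j) * A $$ (i, k) \<noteq> 0"
    using jk(5) by (metis (no_types, lifting) lessThan_iff sum.neutral)
  then show False using row[of i j k] jk by auto
qed

lemma scalar_difference_of_equality: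
  assumes A: "nonneg_mat A" "A \<in> carrier_mat n n" and irr: "irreducible_mat n A"
    and gram: "irreducible_mat n (A\<^sup>T * A)" and n: "n \<ge> 2" and t: "0 < t" "t < 1"
  defines "R \<equiv> \<lambda>d. real_spectral_radius (scale_rows n d A)"
  assumes eq: "ln (R (\<lambda>i. (1 - t) * c i + t * d i)) = (1 - t) * ln (R c) + t * ln (R d)"
  shows "\<exists>k. \<forall>i<n. c i - d i = k"
proof -
  have n0: "n > 0" using n by simp
  define e where "e i = (1 - t) * c i + t * d i" for i
  have scaled: "nonneg_mat (scale_rows n d A)" "scale_rows n d A \<in> carrier_mat n n"
      "irreducible_mat n (scale_rows n d A)" for d
    using nonneg_scale_rows[OF A] irr by (simp_all add: irreducible_scale_rows)
  have R: "0 < R d" for d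
    unfolding R_def by (rule real_spectral_radius_pos[OF scaled n])
  \<comment> \<open>Positivity of all three radii is what permits cancelling \<open>ln\<close>: with
    \<open>ln 0 = 0 = ln 1\<close> it is not injective on nonnegative reals.\<close>
  have Re: "R e = R c powr (1 - t) * R d powr t"
  proof -
    have "ln (R e) = ln (R c powr (1 - t) * R d powr t)"
      using eq R[of c] R[of d] by (simp add: e_def[abs_def] ln_mult ln_powr)
    then show ?thesis using R[of c] R[of d] R[of e] by (subst (asm) ln_inj_iff) auto
  qed
  obtain u where u: "\<And>i. i < n \<Longrightarrow> 0 < u i" "\<And>i. i < n \<Longrightarrow> exp (c i) * mat_act n A u i = R c * u i"
    using perron_vector[OF scaled[of c] n0] by (auto simp: mat_act_scale_rows R_def)
  obtain v where v: "\<And>i. i < n \<Longrightarrow> 0 < v i" "\<And>i. i < n \<Longrightarrow> exp (d i) * mat_act n A v i = R d * v i"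
    using perron_vector[OF scaled[of d] n0] by (auto simp: mat_act_scale_rows R_def)
  have U: "0 < mat_act n A u i" if "i < n" for i
    using u[OF that] R[of c] by (metis exp_gt_zero mult_pos_pos zero_less_mult_pos)
  have V: "0 < mat_act n A v i" if "i < n" for i
    using v[OF that] R[of d] by (metis exp_gt_zero mult_pos_pos zero_less_mult_pos)
  define w where "w i = u i powr (1 - t) * v i powr t" for i
  have w: "0 < w i" if "i < n" for i using u(1) v(1) that by (simp add: w_def order_less_imp_not_eq2)
  \<comment> \<open>The weighted geometric mean of the two eigenvalue equations; the exponentials
    combine to \<open>exp (e i)\<close>.\<close>
  have Rw: "R e * w i = exp (e i) * (mat_act n A u i powr (1 - t) * mat_act n A v i powr t)"
    if i: "i < n" for i
  proof -
    have "R e * w i = (R c * u i) powr (1 - t) * (R d * v i) powr t"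
      using R[of c] R[of d] u(1)[OF i] v(1)[OF i] by (simp add: Re w_def powr_mult)
    also have "\<dots> = (exp (c i) * mat_act n A u i) powr (1 - t) * (exp (d i) * mat_act n A v i) powr t"
      using u(2)[OF i] v(2)[OF i] by simp
    also have "\<dots> = exp (e i) * (mat_act n A u i powr (1 - t) * mat_act n A v i powr t)"
      using U[OF i] V[OF i] by (simp add: powr_mult exp_powr_real e_def exp_add mult_ac)
    finally show ?thesis .
  qed
  have hoelder: "mat_act n A w i \<le> mat_act n A u i powr (1 - t) * mat_act n A v i powr t"
    if "i < n" for i
    unfolding mat_act_def w_def
    using weighted_hoelder(1)[of "{..<n}" "\<lambda>j. A $$ (i, j)" u v t] U[OF that] V[OF that] u(1) v(1) t
      nonneg_mat_entry[OF A that] by (simp add: mat_act_def)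
  have eigen: "mat_act n (scale_rows n e A) w i = R e * w i" if "i < n" for i
    unfolding R_def
  proof (rule super_eigenvector_imp_eigenvector[OF scaled w _ that])
    show "mat_act n (scale_rows n e A) w i \<le> real_spectral_radius (scale_rows n e A) * w i"
      if "i < n" for i
      using hoelder[OF that] Rw[OF that] by (simp add: mat_act_scale_rows[OF that] R_def)
  qed
  have equality: "mat_act n A w i = mat_act n A u i powr (1 - t) * mat_act n A v i powr t"
    if "i < n" for i
  proof -
    have "exp (e i) * mat_act n A w i =
        exp (e i) * (mat_act n A u i powr (1 - t) * mat_act n A v i powr t)"
      using eigen[OF that] Rw[OF that] unfolding mat_act_scale_rows[OF that] by (rule trans)
    then show ?thesis by simp
  qed
  have ratio: "u j / mat_act n A u i = v j / mat_act n A v i"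
    if "i < n" "j < n" "A $$ (i, j) \<noteq> 0" for i j
    using weighted_hoelder(2)[of "{..<n}" "\<lambda>j. A $$ (i, j)" u v t _ _ j] equality[OF that(1)]
      U[OF that(1)] V[OF that(1)] u(1) v(1) t nonneg_mat_entry[OF A that(1)] that
    by (simp add: mat_act_def w_def)
  \<comment> \<open>The right-hand side depends on the row \<open>i\<close> only, so
    \<open>u / v\<close> is constant on the support of each row.\<close>
  have "u j / v j = mat_act n A u i / mat_act n A v i"
    if "i < n" "j < n" "A $$ (i, j) \<noteq> 0" for i j
    using ratio[OF that] U[OF that(1)] V[OF that(1)] v(1)[OF that(2)]
    by (simp add: field_simps)
  then have "u j / v j = u k / v k"
    if "i < n" "j < n" "k < n" "A $$ (i, j) \<noteq> 0" "A $$ (i, k) \<noteq> 0" for i j k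
    using that by metis
  then have const: "u j / v j = u 0 / v 0" if "j < n" for j
    using irreducible_gram_imp_constant[OF A(2) gram, of "\<lambda>j. u j / v j" j 0] that n0 by blast
  define q where "q = u 0 / v 0"
  have q: "0 < q" using u(1) v(1) n0 by (simp add: q_def)
  have uq: "u j = q * v j" if "j < n" for j
    using const[OF that] v(1)[OF that] by (simp add: q_def field_simps)
  \<comment> \<open>Since \<open>u = q v\<close>, both eigenvalue equations in row \<open>i\<close>
    involve \<open>mat_act n A v i\<close> and \<open>v i\<close>; dividing them leaves a quotient
    independent of \<open>i\<close>.\<close>
  have "c i - d i = ln (R c) - ln (R d)" if i: "i < n" for i
  proof -
    have "mat_act n A u i = q * mat_act n A v i"
      unfolding mat_act_def sum_distrib_left by (rule sum.cong) (auto simp: uq)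
    then have "exp (c i) * mat_act n A v i = R c * v i"
      using u(2)[OF i] q uq[OF i] by simp
    then have "ln (exp (c i) * mat_act n A v i) = ln (R c * v i)" by simp
    moreover have "ln (exp (d i) * mat_act n A v i) = ln (R d * v i)" using v(2)[OF i] by simp
    ultimately show ?thesis
      using V[OF i] v(1)[OF i] R[of c] R[of d] by (simp add: ln_mult)
  qed
  then show ?thesis by blast
qed

section \<open>Necessity\<close>

definition mask :: "nat \<Rightarrow> nat set \<Rightarrow> 'a::zero mat \<Rightarrow> 'a mat" where
  "mask n S M = mat n n (\<lambda>(i, j). if i \<in> S \<and> j \<in> S then M $$ (i, j) else 0)"

lemma mask_simps [simp]:
  "mask n S M \<in> carrier_mat n n"
  "i < n \<Longrightarrow> j < n \<Longrightarrow> mask n S M $$ (i, j) = (if i \<in> S \<and> j \<in> S then M $$ (i, j) else 0)"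
  by (auto simp: mask_def)

lemma transpose_mask: "M \<in> carrier_mat n n \<Longrightarrow> (mask n S M)\<^sup>T = mask n S M\<^sup>T"
  by (auto simp: mask_def intro!: eq_matI)

lemma cmat_mask: "M \<in> carrier_mat n n \<Longrightarrow> cmat (mask n S M) = mask n S (cmat M)"
  by (auto simp: mask_def intro!: eq_matI)

lemma eigenvalue_transpose:
  assumes "M \<in> carrier_mat n n"
  shows "eigenvalue M\<^sup>T k \<longleftrightarrow> eigenvalue M (k :: 'a :: field)"
  using assms eigenvalue_root_char_poly[of M n k] eigenvalue_root_char_poly[of "M\<^sup>T" n k] by simp

lemma reducible_matE:
  assumes "\<not> irreducible_mat n A"
  obtains S1 S2 where "S1 \<noteq> {}" "S2 \<noteq> {}" "S1 \<inter> S2 = {}" "S1 \<union> S2 = {0..<n}"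
    "\<forall>i\<in>S1. \<forall>j\<in>S2. A $$ (i, j) = 0"
proof -
  have "\<exists>S1 S2. S1 \<noteq> {} \<and> S2 \<noteq> {} \<and> S1 \<inter> S2 = {} \<and> S1 \<union> S2 = {0..<n} \<and>
      (\<forall>i\<in>S1. \<forall>j\<in>S2. A $$ (i, j) = 0)"
    using assms unfolding irreducible_mat_def not_not .
  then show ?thesis by (elim exE conjE) (rule that)
qed

text \<open>Block triangular form without reordering indices: the diagonal blocks are the masks,
  padded by zeros to full size. The field is arbitrary because both a real matrix and its complex
  image are needed.\<close>

locale zero_block =
  fixes n :: nat and S1 S2 :: "nat set" and M :: "'a :: field mat"
  assumes carrier: "M \<in> carrier_mat n n"
    and parts: "S1 \<inter> S2 = {}" "S1 \<union> S2 = {0..<n}"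
    and zero: "i \<in> S1 \<Longrightarrow> j \<in> S2 \<Longrightarrow> M $$ (i, j) = 0"
begin

lemma in_fst_iff: "i < n \<Longrightarrow> i \<in> S1 \<longleftrightarrow> i \<notin> S2"
  using parts by (metis Int_iff Un_iff atLeast0LessThan empty_iff lessThan_iff)

lemma transpose_zero_block: "zero_block n S2 S1 M\<^sup>T"
proof
  show "M\<^sup>T $$ (i, j) = 0" if "i \<in> S2" "j \<in> S1" for i j
  proof -
    have "i < n" "j < n" using that parts(2) by auto
    then show ?thesis using carrier zero[OF that(2,1)] by simp
  qed
qed (use carrier parts in auto)

text \<open>The zero padding may create the eigenvalue 0, hence \<open>k \<noteq> 0\<close>. It
  forces the eigenvector of the mask to vanish off \<open>S2\<close>, so the zero block makes
  \<open>M\<close> act on it as the mask does.\<close>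

lemma eigenvalue_mask_snd:
  assumes "k \<noteq> 0" "eigenvalue (mask n S2 M) k"
  shows "eigenvalue M k"
proof -
  obtain z where z: "\<exists>i<n. z i \<noteq> 0" "\<And>i. i < n \<Longrightarrow> mat_act n (mask n S2 M) z i = k * z i"
    using assms(2) eigenvalue_iff_mat_act[of "mask n S2 M" n k] by auto
  have z0: "z i = 0" if "i < n" "i \<notin> S2" for i
    using z(2)[OF that(1)] that assms(1) by (simp add: mat_act_def)
  have "mat_act n M z i = mat_act n (mask n S2 M) z i" if "i < n" for i
    unfolding mat_act_def
  proof (rule sum.cong)
    fix j assume "j \<in> {..<n}"
    then show "M $$ (i, j) * z j = mask n S2 M $$ (i, j) * z j"
      using that z0[of j] zero[of i j] in_fst_iff[of i] by (cases "j \<in> S2") auto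
  qed simp
  then show ?thesis using z eigenvalue_iff_mat_act[OF carrier] by metis
qed

text \<open>Transposition keeps the eigenvalues and exchanges the two parts.\<close>

lemma eigenvalue_mask_fst:
  assumes "k \<noteq> 0" "eigenvalue (mask n S1 M) k"
  shows "eigenvalue M k"
proof -
  have "eigenvalue (mask n S1 M\<^sup>T) k"
    using assms(2) transpose_mask[OF carrier] eigenvalue_transpose[of "mask n S1 M" n] by simp
  then have "eigenvalue M\<^sup>T k"
    using zero_block.eigenvalue_mask_snd[OF transpose_zero_block assms(1)] by blast
  then show ?thesis using eigenvalue_transpose[OF carrier] by simp
qed

text \<open>Rows in \<open>S1\<close> do not see \<open>S2\<close>, so an eigenvector that is
  nonzero on \<open>S1\<close> restricts to one of the first mask. Otherwise it lives on
  \<open>S2\<close> and is itself one of the second.\<close>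

lemma eigenvalue_mask_cases:
  assumes "eigenvalue M k"
  shows "eigenvalue (mask n S1 M) k \<or> eigenvalue (mask n S2 M) k"
proof -
  obtain z where z: "\<exists>i<n. z i \<noteq> 0" "\<And>i. i < n \<Longrightarrow> mat_act n M z i = k * z i"
    using assms eigenvalue_iff_mat_act[OF carrier] by auto
  show ?thesis
  proof (cases "\<exists>i\<in>S1. z i \<noteq> 0")
    case True
    define y where "y i = (if i \<in> S1 then z i else 0)" for i
    have "mat_act n (mask n S1 M) y i = k * y i" if "i < n" for i
    proof (cases "i \<in> S1")
      case True
      have "mat_act n (mask n S1 M) y i = mat_act n M z i"
        unfolding mat_act_def
      proof (rule sum.cong)
        fix j assume "j \<in> {..<n}"
        then show "mask n S1 M $$ (i, j) * y j = M $$ (i, j) * z j"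
          using that True zero[of i j] in_fst_iff[of j] by (cases "j \<in> S2") (auto simp: y_def)
      qed simp
      then show ?thesis using z(2)[OF that] True by (simp add: y_def)
    qed (use that in \<open>simp add: mat_act_def y_def\<close>)
    moreover have "\<exists>i<n. y i \<noteq> 0" using True parts(2) by (force simp: y_def)
    ultimately show ?thesis using eigenvalue_iff_mat_act[of "mask n S1 M" n k] by auto
  next
    case False
    have "mat_act n (mask n S2 M) z i = k * z i" if "i < n" for i
    proof (cases "i \<in> S2")
      case True
      have "mat_act n (mask n S2 M) z i = mat_act n M z i"
        unfolding mat_act_def
      proof (rule sum.cong)
        fix j assume "j \<in> {..<n}"
        then show "mask n S2 M $$ (i, j) * z j = M $$ (i, j) * z j"
          using that True False in_fst_iff[of j] by (cases "j \<in> S2") auto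
      qed simp
      then show ?thesis using z(2)[OF that] by simp
    next
      case i: False
      then have "z i = 0" using False that parts(2) by auto
      then show ?thesis using i that by (simp add: mat_act_def)
    qed
    then show ?thesis using z(1) eigenvalue_iff_mat_act[of "mask n S2 M" n k] by auto
  qed
qed

end

text \<open>Nonzero eigenvalues of the masks are eigenvalues of \<open>M\<close>, and every
  eigenvalue of \<open>M\<close> occurs in a mask. The extra eigenvalue 0 of a mask cannot exceed a
  spectral radius.\<close>

lemma real_spectral_radius_zero_block:
  assumes M: "zero_block n S1 S2 M" and n: "n > 0"
  shows "real_spectral_radius M =
    max (real_spectral_radius (mask n S1 M)) (real_spectral_radius (mask n S2 M))"
proof (rule antisym)
  interpret r: zero_block n S1 S2 M by (rule M)
  interpret c: zero_block n S1 S2 "cmat M"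
  proof
    show "cmat M $$ (i, j) = 0" if "i \<in> S1" "j \<in> S2" for i j
    proof -
      have "i < n" "j < n" using that r.parts(2) by auto
      then show ?thesis using r.carrier r.zero[OF that] by simp
    qed
  qed (use r.carrier r.parts in auto)
  obtain k where k: "eigenvalue (cmat M) k" "norm k = real_spectral_radius M"
    using real_spectral_radius_attained[OF r.carrier n] .
  then have "eigenvalue (cmat (mask n S1 M)) k \<or> eigenvalue (cmat (mask n S2 M)) k"
    using c.eigenvalue_mask_cases by (simp add: cmat_mask[OF r.carrier])
  then show "real_spectral_radius M \<le>
      max (real_spectral_radius (mask n S1 M)) (real_spectral_radius (mask n S2 M))"
    using norm_le_real_spectral_radius[of _ n k, OF mask_simps(1) n] k(2) by fastforce
  have "real_spectral_radius (mask n S M) \<le> real_spectral_radius M" if "S = S1 \<or> S = S2" for S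
  proof -
    obtain k where k: "eigenvalue (cmat (mask n S M)) k" "norm k = real_spectral_radius (mask n S M)"
      using real_spectral_radius_attained[OF mask_simps(1) n] .
    show ?thesis
    proof (cases "k = 0")
      case True
      then show ?thesis using k(2) real_spectral_radius_nonneg[OF r.carrier n] by simp
    next
      case False
      then have "eigenvalue (cmat M) k"
        using k(1) that c.eigenvalue_mask_fst c.eigenvalue_mask_snd
        by (auto simp: cmat_mask[OF r.carrier])
      then show ?thesis using norm_le_real_spectral_radius[OF r.carrier n] k(2) by metis
    qed
  qed
  then show "max (real_spectral_radius (mask n S1 M)) (real_spectral_radius (mask n S2 M))
      \<le> real_spectral_radius M" by simp
qed

text \<open>The instance \<open>C = 0\<close>, \<open>t = 1/2\<close> of Property 1, against which
  both necessity proofs test an explicit nonconstant \<open>d\<close>.\<close>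

lemma property1_midpoint:
  assumes A: "A \<in> carrier_mat n n" and p1: "property1 n A"
  defines "R \<equiv> \<lambda>d. ln (real_spectral_radius (scale_rows n d A))"
  assumes eq: "R (\<lambda>i. d i / 2) = (R (\<lambda>i. 0) + R d) / 2"
  obtains k where "\<And>i. i < n \<Longrightarrow> d i = k"
proof -
  have *: "(\<exists>t\<in>{0<..<1}. R (\<lambda>i. (1 - t) * 0 + t * d i) = (1 - t) * R (\<lambda>i. 0) + t * R d)
      \<longrightarrow> (\<exists>k. \<forall>i<n. 0 - d i = k)"
    unfolding R_def
    by (rule p1[unfolded property1_iff[OF A], THEN spec[where x = "\<lambda>i. 0"], THEN spec[where x = d]])
  have "R (\<lambda>i. (1 - 1 / 2) * 0 + 1 / 2 * d i) = (1 - 1 / 2) * R (\<lambda>i. 0) + 1 / 2 * R d"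
    using eq by (simp add: add_divide_distrib)
  then have "\<exists>k. \<forall>i<n. 0 - d i = k"
    by (intro *[THEN mp] bexI[of _ "1 / 2"]) auto
  then obtain k where "\<forall>i<n. 0 - d i = k" ..
  then have "d i = - k" if "i < n" for i using that by force
  then show ?thesis by (rule that)
qed

text \<open>Scaling only the rows in \<open>S1\<close>, in the direction in which the block with the larger spectral
  radius stays dominant, makes the logarithm of the spectral radius affine.\<close>

lemma property1_imp_irreducible:
  assumes n: "n > 0" and A: "A \<in> carrier_mat n n" and p1: "property1 n A"
  shows "irreducible_mat n A"
proof (rule ccontr)
  assume "\<not> irreducible_mat n A"
  then obtain S1 S2 where S: "S1 \<noteq> {}" "S2 \<noteq> {}" "S1 \<inter> S2 = {}" "S1 \<union> S2 = {0..<n}"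
    "\<forall>i\<in>S1. \<forall>j\<in>S2. A $$ (i, j) = 0"
    by (rule reducible_matE)
  define d :: "nat \<Rightarrow> real" where "d i = (if i \<in> S1 then 1 else 0)" for i
  define r where "r S = real_spectral_radius (mask n S A)" for S
  have r: "0 \<le> r S" for S
    unfolding r_def by (rule real_spectral_radius_nonneg[OF mask_simps(1) n])
  define R where "R s = real_spectral_radius (scale_rows n (\<lambda>i. s * d i) A)" for s
  have R: "R s = max (exp s * r S1) (r S2)" for s
  proof -
    have "zero_block n S1 S2 (scale_rows n (\<lambda>i. s * d i) A)"
    proof
      show "scale_rows n (\<lambda>i. s * d i) A $$ (i, j) = 0" if "i \<in> S1" "j \<in> S2" for i j
      proof -
        have "i < n" "j < n" using that S(4) by auto
        then show ?thesis using S(5) that by simp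
      qed
    qed (use S in auto)
    moreover have "mask n S1 (scale_rows n (\<lambda>i. s * d i) A) = exp s \<cdot>\<^sub>m mask n S1 A"
      by (auto simp: mask_def scale_rows_def d_def intro!: eq_matI)
    moreover have "mask n S2 (scale_rows n (\<lambda>i. s * d i) A) = mask n S2 A"
      using S(3) by (auto simp: mask_def scale_rows_def d_def intro!: eq_matI)
    ultimately show ?thesis
      using real_spectral_radius_zero_block[OF _ n] real_spectral_radius_smult[OF mask_simps(1) n]
      by (simp add: R_def r_def)
  qed
  have not_affine: "ln (R (s / 2)) \<noteq> (ln (R 0) + ln (R s)) / 2" if "s \<noteq> 0" for s
  proof
    assume "ln (R (s / 2)) = (ln (R 0) + ln (R s)) / 2"
    then obtain k where k: "\<And>i. i < n \<Longrightarrow> s * d i = k"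
      using property1_midpoint[OF A p1, of "\<lambda>i. s * d i"] by (auto simp: R_def)
    obtain a b where ab: "a \<in> S1" "b \<in> S2" using S by blast
    then have "a < n" "b < n" "b \<notin> S1" using S(3,4) by auto
    then show False using k[of a] k[of b] ab that by (simp add: d_def)
  qed
  show False
  proof (cases "r S2 \<le> r S1")
    case True
    have R_nonneg: "R s = exp s * r S1" if "0 \<le> s" for s
    proof -
      have "1 * r S1 \<le> exp s * r S1" using r[of S1] that by (intro mult_right_mono) auto
      then show ?thesis using True by (simp add: R)
    qed
    show False
    proof (cases "r S1 = 0")
      case True
      \<comment> \<open>All radii involved are zero here, so the midpoint equation relates equal
        values of \<open>ln 0\<close> and holds trivially.\<close>
      then show False using not_affine[of 1] by (simp add: R_nonneg)
    next
      case False
      then have "0 < r S1" using r[of S1] by simp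
      then show False using not_affine[of 1] by (simp add: R_nonneg ln_mult)
    qed
  next
    case False
    have "R s = r S2" if "s \<le> 0" for s
    proof -
      have "exp s * r S1 \<le> 1 * r S1" using r[of S1] that by (intro mult_right_mono) auto
      then show ?thesis using False by (simp add: R)
    qed
    then show False using not_affine[of "-1"] by simp
  qed
qed

text \<open>If \<open>A\<^sup>T * A\<close> is reducible, the support of each row of \<open>A\<close> lies in one of two parts. Scaling a
  Perron vector on the second part then yields Perron vectors of row scalings of \<open>A\<close> for the same
  eigenvalue.\<close>

lemma property1_imp_irreducible_gram:
  assumes n: "n > 0" and A: "nonneg_mat A" "A \<in> carrier_mat n n" and p1: "property1 n A"
  shows "irreducible_mat n (A\<^sup>T * A)"
proof (rule ccontr)
  have irr: "irreducible_mat n A" by (rule property1_imp_irreducible[OF n A(2) p1])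
  assume "\<not> irreducible_mat n (A\<^sup>T * A)"
  then obtain S1 S2 where S: "S1 \<noteq> {}" "S2 \<noteq> {}" "S1 \<inter> S2 = {}" "S1 \<union> S2 = {0..<n}"
    "\<forall>i\<in>S1. \<forall>j\<in>S2. (A\<^sup>T * A) $$ (i, j) = 0"
    by (rule reducible_matE)
  \<comment> \<open>A vanishing entry of the Gram matrix is a sum of nonnegative products, so each
    product vanishes.\<close>
  have disjoint: "A $$ (i, j) = 0 \<or> A $$ (i, k) = 0" if "i < n" "j \<in> S1" "k \<in> S2" for i j k
  proof -
    have jk: "j < n" "k < n" using that S(4) by auto
    have "(\<Sum>l<n. A $$ (l, j) * A $$ (l, k)) = (A\<^sup>T * A) $$ (j, k)"
      using A(2) jk by (auto simp: scalar_prod_def atLeast0LessThan)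
    then have "(\<Sum>l<n. A $$ (l, j) * A $$ (l, k)) = 0" using S(5) that by simp
    then have "A $$ (i, j) * A $$ (i, k) = 0"
      using that(1) jk nonneg_mat_entry[OF A] by (subst (asm) sum_nonneg_eq_0_iff) auto
    then show ?thesis by simp
  qed
  \<comment> \<open>\<open>h\<close> marks the columns in \<open>S2\<close> and \<open>g\<close> the
    rows that meet \<open>S2\<close>. As \<open>h j = g i\<close> on nonzero entries, scaling row
    \<open>i\<close> by \<open>exp (s * (h i - g i))\<close> is conjugation of \<open>A\<close> by
    the diagonal matrix with entries \<open>exp (s * h i)\<close>.\<close>
  define h :: "nat \<Rightarrow> real" where "h j = (if j \<in> S2 then 1 else 0)" for j
  define g :: "nat \<Rightarrow> real" where "g i = (if \<exists>k\<in>S2. A $$ (i, k) \<noteq> 0 then 1 else 0)" for i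
  define d where "d i = h i - g i" for i
  have hg: "h j = g i" if "i < n" "j < n" "A $$ (i, j) \<noteq> 0" for i j
    using disjoint[OF that(1)] that S(4) by (cases "j \<in> S1") (auto simp: h_def g_def)
  obtain x where x: "\<And>i. i < n \<Longrightarrow> 0 < x i"
    "\<And>i. i < n \<Longrightarrow> mat_act n A x i = real_spectral_radius A * x i"
    using perron_vector[OF A irr n] by blast
  have R: "real_spectral_radius (scale_rows n (\<lambda>i. s * d i) A) = real_spectral_radius A" for s
  proof (rule real_spectral_radius_eqI[OF nonneg_scale_rows[OF A] scale_rows_simps(1) n])
    fix i assume i: "i < n"
    show "0 < exp (s * h i) * x i" using x(1)[OF i] by simp
    have "mat_act n A (\<lambda>j. exp (s * h j) * x j) i = exp (s * g i) * mat_act n A x i"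
      unfolding mat_act_def sum_distrib_left
    proof (rule sum.cong)
      fix j assume "j \<in> {..<n}"
      then show "A $$ (i, j) * (exp (s * h j) * x j) = exp (s * g i) * (A $$ (i, j) * x j)"
        using hg[of i j] i by (cases "A $$ (i, j) = 0") auto
    qed simp
    then have "mat_act n (scale_rows n (\<lambda>i. s * d i) A) (\<lambda>j. exp (s * h j) * x j) i =
        (exp (s * d i) * exp (s * g i)) * (real_spectral_radius A * x i)"
      using x(2)[OF i] by (simp add: mat_act_scale_rows[OF i])
    also have "exp (s * d i) * exp (s * g i) = exp (s * h i)"
      by (simp add: d_def exp_add[symmetric] algebra_simps)
    finally show "mat_act n (scale_rows n (\<lambda>i. s * d i) A) (\<lambda>j. exp (s * h j) * x j) i =
        real_spectral_radius A * (exp (s * h i) * x i)"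
      by (simp add: algebra_simps)
  qed
  obtain k where k: "\<And>i. i < n \<Longrightarrow> d i = k"
    using property1_midpoint[OF A(2) p1, of d] R[of "1 / 2"] R[of 0] R[of 1] by auto
  obtain a b where ab: "a \<in> S1" "b \<in> S2" using S by blast
  then have abn: "a < n" "b < n" using S(4) by auto
  have ha: "h a = 0" "h b = 1" using ab S(3) by (auto simp: h_def)
  \<comment> \<open>The constant \<open>k\<close> is \<open>- g a\<close>, hence at most 0, and also
    \<open>1 - g b\<close>, hence at least 0.\<close>
  have "0 \<le> g a" "g b \<le> 1" by (simp_all add: g_def)
  then have "k = 0" using k[OF abn(1)] k[OF abn(2)] ha by (simp add: d_def)
  then have eq: "h i = g i" if "i < n" for i using k[OF that] by (simp add: d_def)
  \<comment> \<open>With \<open>h = g\<close>, nonzero entries of \<open>A\<close> join only indices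
    with equal \<open>h\<close>, which contradicts irreducibility of \<open>A\<close>.\<close>
  obtain i j where ij: "i < n" "j < n" "h i = 0" "h j \<noteq> 0" "A $$ (i, j) \<noteq> 0"
    using irreducible_matD[OF irr, of a "\<lambda>i. h i = 0" b] abn ha by (metis zero_neq_one)
  then show False using hg[OF ij(1,2,5)] eq[OF ij(1)] by simp
qed

theorem theorem10:
  fixes A :: "real mat" and n :: nat
  assumes "n \<ge> 1" and "A \<in> carrier_mat n n" and "nonneg_mat A"
  shows "property1 n A \<longleftrightarrow> irreducible_mat n A \<and> irreducible_mat n (A\<^sup>T * A)"
proof (intro iffI conjI)
  assume "property1 n A"
  then show "irreducible_mat n A" "irreducible_mat n (A\<^sup>T * A)"
    using property1_imp_irreducible property1_imp_irreducible_gram assms by auto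
next
  assume irr: "irreducible_mat n A \<and> irreducible_mat n (A\<^sup>T * A)"
  show "property1 n A"
  \<comment> \<open>For \<open>n = 1\<close> every difference is scalar. This case is separate
    because the spectral radius may be zero there.\<close>
  proof (cases "n = 1")
    case True
    then show ?thesis unfolding property1_iff[OF assms(2)] by simp
  next
    case False
    then have "n \<ge> 2" using assms(1) by simp
    then show ?thesis
      unfolding property1_iff[OF assms(2)]
      using scalar_difference_of_equality[OF assms(3,2)] irr by auto
  qed
qed

end
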